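(* For all integers $n\geq 2$, we have $$|S_n^{(2)}(123:213)|=2n-2.$$
   Context: $S_n$ denotes the set of permutations $p=p(1)p(2)\cdots p(n)$ of $\{1,2,\ldots,n\}$ in one-line notation. For $p\in S_n$ and $q\in S_m$, $p$ contains $q$ as a pattern if there exist $1\leq i_1<\cdots<i_m\leq n$ such that for all $1\leq a<b\leq m$, $p(i_a)<p(i_b)$ if and only if $q(a)<q(b)$; otherwise $p$ avoids $q$. For $p\in S_n$ with $n\geq 2$, $p^{(2)}=p(2)p(3)\cdots p(n)p(1)$. For $q_1,q_2\in S_3$, $S_n^{(2)}(q_1:q_2)$ is the set of $p\in S_n$ such that $p$ avoids $q_1$ and $p^{(2)}$ avoids $q_2$. *)

theory Defs
  imports "HOL-Combinatorics.Multiset_Permutations"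
begin

text \<open>
  A permutation in one-line notation is the list of its values, so the value \<open>p(i)\<close>
  is \<open>p ! (i - 1)\<close>, and \<open>S\<^sub>n\<close> is \<^term>\<open>permutations_of_set {1..n::nat}\<close>.
\<close>

definition contains_pattern :: "nat list \<Rightarrow> nat list \<Rightarrow> bool" where
  "contains_pattern p q \<longleftrightarrow>
     (\<exists>i :: nat \<Rightarrow> nat. strict_mono_on {..<length q} i \<and>
        i ` {..<length q} \<subseteq> {..<length p} \<and>
        (\<forall>a b. a < b \<and> b < length q \<longrightarrow> (p ! i a < p ! i b \<longleftrightarrow> q ! a < q ! b)))"

abbreviation avoids_pattern :: "nat list \<Rightarrow> nat list \<Rightarrow> bool" where
  "avoids_pattern p q \<equiv> \<not> contains_pattern p q"

text \<open>
  The permutation \<open>p(2) p(3) \<dots> p(n) p(1)\<close> is \<^term>\<open>rotate1 p\<close>.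
\<close>

definition S2 :: "nat \<Rightarrow> nat list \<Rightarrow> nat list \<Rightarrow> nat list set" where
  "S2 n q1 q2 =
     {p \<in> permutations_of_set {1..n}. avoids_pattern p q1 \<and> avoids_pattern (rotate1 p) q2}"

end

theory Submission
  imports Defs "HOL-Library.Sublist"
begin

text \<open>
  Write \<open>p = x # w\<close>, so that \<open>rotate1 p = w @ [x]\<close>. The entries of \<open>w\<close> above \<open>x\<close> must decrease
  (else \<open>x\<close> starts a 123) and those below \<open>x\<close> must increase (else \<open>x\<close> ends a 213). Hence
  \<open>x \<le> 3\<close>, since otherwise \<open>1, 2, 3\<close> would increase in \<open>w\<close>. The entries of \<open>w\<close> other than \<open>1\<close>
  then decrease: for \<open>x = 3\<close> nothing larger can follow \<open>2\<close>, as \<open>1\<close> precedes it. So only the position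
  of \<open>1\<close> is free: \<open>1\<close> choice for \<open>x = 1\<close>, \<open>n - 1\<close> choices for \<open>x = 2\<close>, and \<open>n - 2\<close> for \<open>x = 3\<close>.
\<close>

section \<open>Patterns as subsequences\<close>

text \<open>This trades index maps for \<open>subseq\<close>. Forwards, a skipped head shifts
  \<open>i\<close> by one and a matched head adds position 0. Backwards, induction runs from the
  right: the position of the last entry bounds all earlier ones, so the remaining entries embed into
  a prefix of \<open>p\<close>.\<close>

lemma subseq_iff_strict_mono:
  "subseq s p \<longleftrightarrow>
     (\<exists>i :: nat \<Rightarrow> nat. strict_mono_on {..<length s} i \<and>
        i ` {..<length s} \<subseteq> {..<length p} \<and> (\<forall>a < length s. s ! a = p ! i a))"
    (is "?L \<longleftrightarrow> (\<exists>i. ?R s p i)")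
proof
  show "\<exists>i. ?R s p i" if ?L
    using that
  proof (induction rule: list_emb.induct)
    case (list_emb_Nil p)
    show ?case by (simp add: strict_mono_on_def)
  next
    case (list_emb_Cons s p y)
    then obtain i where "?R s p i" by blast
    then have "?R s (y # p) (\<lambda>a. Suc (i a))"
      by (auto simp: strict_mono_on_def)
    then show ?case by blast
  next
    case (list_emb_Cons2 x y s p)
    then obtain i where "?R s p i" by blast
    \<comment> \<open>The matched head goes to position 0; every other index moves up by
      one.\<close>
    then have "?R (x # s) (y # p) (case_nat 0 (\<lambda>a. Suc (i a)))"
      using \<open>x = y\<close> by (auto simp: strict_mono_on_def image_subset_iff nth_Cons split: nat.splits)
    then show ?case by blast
  qed
  show ?L if "\<exists>i. ?R s p i"
    using that
  proof (induction s arbitrary: p rule: rev_induct)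
    case Nil
    show ?case by simp
  next
    case (snoc y s)
    then obtain i where i: "?R (s @ [y]) p i" by blast
    let ?m = "i (length s)"
    have m: "?m < length p" and y: "y = p ! ?m"
      using i by (auto simp: image_subset_iff)
    have lt: "i a < ?m" if "a < length s" for a
      using i that by (auto simp: strict_mono_on_def)
    have "?R s (take ?m p) i"
      using i lt m by (auto simp: strict_mono_on_def image_subset_iff nth_append less_Suc_eq)
    then have "subseq s (take ?m p)"
      using snoc.IH by blast
    then have "subseq (s @ [y]) (take ?m p @ p ! ?m # drop (Suc ?m) p)"
      using y by (intro list_emb_append_mono) auto
    then show ?case
      using id_take_nth_drop[OF m] by simp
  qed
qed

text \<open>An occurrence is represented by its list of values \<open>s\<close>; the positions are
  hidden in \<open>subseq\<close>.\<close>

lemma contains_pattern_iff_subseq: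
  "contains_pattern p q \<longleftrightarrow>
     (\<exists>s. subseq s p \<and> length s = length q \<and>
        (\<forall>a b. a < b \<and> b < length q \<longrightarrow> (s ! a < s ! b \<longleftrightarrow> q ! a < q ! b)))"
    (is "_ \<longleftrightarrow> ?R")
proof
  assume "contains_pattern p q"
  then obtain i where i: "strict_mono_on {..<length q} i" "i ` {..<length q} \<subseteq> {..<length p}"
    "\<forall>a b. a < b \<and> b < length q \<longrightarrow> (p ! i a < p ! i b \<longleftrightarrow> q ! a < q ! b)"
    by (auto simp: contains_pattern_def)
  let ?s = "map (\<lambda>a. p ! i a) [0..<length q]"
  have "subseq ?s p"
    unfolding subseq_iff_strict_mono using i by (intro exI[of _ i]) auto
  then show ?R
    using i(3) by (intro exI[of _ ?s]) auto
next
  assume ?R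
  then obtain s i where "length s = length q" "strict_mono_on {..<length s} i"
    "i ` {..<length s} \<subseteq> {..<length p}" "\<forall>a < length s. s ! a = p ! i a"
    "\<forall>a b. a < b \<and> b < length q \<longrightarrow> (s ! a < s ! b \<longleftrightarrow> q ! a < q ! b)"
    unfolding subseq_iff_strict_mono by blast
  then show "contains_pattern p q"
    unfolding contains_pattern_def by (intro exI[of _ i]) auto
qed

text \<open>Only \<open><\<close> is compared, so a descent of the pattern yields merely a negated
  \<open><\<close>. Distinctness of the entries has to turn it into a strict descent later.\<close>

lemma contains_pattern3:
  "contains_pattern p [x, y, z] \<longleftrightarrow>
     (\<exists>a b c. subseq [a, b, c] p \<and> (a < b \<longleftrightarrow> x < y) \<and> (a < c \<longleftrightarrow> x < z) \<and> (b < c \<longleftrightarrow> y < z))"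
proof -
  have all3: "(\<forall>a b. a < b \<and> b < 3 \<longrightarrow> P a b) \<longleftrightarrow> P 0 1 \<and> P 0 2 \<and> P 1 2"
    for P :: "nat \<Rightarrow> nat \<Rightarrow> bool"
    by (auto simp: numeral_eq_Suc less_Suc_eq)
  have len: "length [x, y, z] = 3" by simp
  have ex3: "(\<exists>s. length s = 3 \<and> P s) \<longleftrightarrow> (\<exists>a b c. P [a, b, c])" for P :: "nat list \<Rightarrow> bool"
    by (force simp: numeral_eq_Suc length_Suc_conv)
  have "contains_pattern p [x, y, z] \<longleftrightarrow> (\<exists>s. length s = 3 \<and> subseq s p \<and>
      (s ! 0 < s ! 1 \<longleftrightarrow> x < y) \<and> (s ! 0 < s ! 2 \<longleftrightarrow> x < z) \<and> (s ! 1 < s ! 2 \<longleftrightarrow> y < z))"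
    unfolding contains_pattern_iff_subseq len all3 by (auto simp: numeral_eq_Suc)
  also have "\<dots> \<longleftrightarrow> (\<exists>a b c. subseq [a, b, c] p \<and>
      (a < b \<longleftrightarrow> x < y) \<and> (a < c \<longleftrightarrow> x < z) \<and> (b < c \<longleftrightarrow> y < z))"
    unfolding ex3 by simp
  finally show ?thesis .
qed

section \<open>Subsequences and decreasing lists\<close>

text \<open>A two-entry subsequence either starts at the head or lies in the tail. Monotonicity
  conditions thus take the same form as pattern conditions.\<close>

lemma sorted_wrt_iff_subseq: "sorted_wrt R xs \<longleftrightarrow> (\<forall>a b. subseq [a, b] xs \<longrightarrow> R a b)"
proof (induction xs)
  case Nil
  show ?case by simp
next
  case (Cons x xs)
  have "subseq [a, b] (x # xs) \<longleftrightarrow> a = x \<and> b \<in> set xs \<or> subseq [a, b] xs" for a b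
    using subseq_Cons'[of a "[b]" xs]
    by (auto simp: subseq_singleton_left)
  then show ?case
    using Cons.IH by auto
qed

text \<open>The first entry can only be matched inside \<open>v\<close>, and the others are matched
  after it.\<close>

lemma subseq_Cons_append_notin:
  assumes "subseq (a # s) (u @ v)" "a \<notin> set u"
  shows "subseq (a # s) v"
  using assms by (induction u) auto

lemma subseq_distinct:
  assumes "subseq xs ys" "distinct ys"
  shows "distinct xs"
  using assms unfolding subseq_conv_nths by (metis distinct_nthsI)

lemma strict_desc_unique:
  fixes xs ys :: "'a :: linorder list"
  assumes "sorted_wrt (>) xs" "sorted_wrt (>) ys" "set xs = set ys"
  shows "xs = ys"
proof -
  have "sorted_wrt (<) (rev xs)" "sorted_wrt (<) (rev ys)"
    using assms by (simp_all add: sorted_wrt_rev)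
  then have "rev xs = rev ys"
    using assms(3) by (intro sorted_distinct_set_unique) (auto simp: strict_sorted_iff)
  then show ?thesis by simp
qed

section \<open>Inserting one entry into a list\<close>

definition insertions :: "'a \<Rightarrow> 'a list \<Rightarrow> 'a list set" where
  "insertions a xs = {u @ a # v |u v. u @ v = xs}"

text \<open>Deleting the single \<open>a\<close> undoes the insertion. This connects the count of
  insertions with conditions on \<open>filter (\<lambda>b. b \<noteq> 1) w\<close>.\<close>

lemma insertions_eq:
  assumes "a \<notin> set xs"
  shows "insertions a xs = {w. filter (\<lambda>b. b \<noteq> a) w = xs \<and> count_list w a = 1}"
proof (intro equalityI subsetI)
  fix w assume "w \<in> insertions a xs"
  then obtain u v where "w = u @ a # v" "u @ v = xs"
    by (auto simp: insertions_def)
  moreover from this have "filter (\<lambda>b. b \<noteq> a) u = u" "filter (\<lambda>b. b \<noteq> a) v = v"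
    using assms by (auto simp: filter_id_conv)
  ultimately show "w \<in> {w. filter (\<lambda>b. b \<noteq> a) w = xs \<and> count_list w a = 1}"
    using assms by (auto simp: count_list_0_iff)
next
  fix w assume w: "w \<in> {w. filter (\<lambda>b. b \<noteq> a) w = xs \<and> count_list w a = 1}"
  then have "a \<in> set w"
    using count_list_0_iff[of w a] by fastforce
  then obtain u v where uv: "w = u @ a # v" by (meson split_list)
  with w have "a \<notin> set u" "a \<notin> set v"
    by (auto simp: count_list_0_iff[symmetric])
  then have "filter (\<lambda>b. b \<noteq> a) u = u" "filter (\<lambda>b. b \<noteq> a) v = v"
    by (auto simp: filter_id_conv)
  with w uv show "w \<in> insertions a xs"
    by (auto simp: insertions_def)
qed

lemma card_insertions:
  assumes "a \<notin> set xs"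
  shows "finite (insertions a xs)" "card (insertions a xs) = Suc (length xs)"
proof -
  let ?f = "\<lambda>i. take i xs @ a # drop i xs"
  have eq: "insertions a xs = ?f ` {..length xs}"
  proof (intro equalityI subsetI)
    fix w assume "w \<in> insertions a xs"
    then obtain u v where "w = u @ a # v" "u @ v = xs"
      by (auto simp: insertions_def)
    then have "w = ?f (length u)" "length u \<le> length xs" by auto
    then show "w \<in> ?f ` {..length xs}" by blast
  qed (force simp: insertions_def)
  have "inj_on ?f {..length xs}"
  proof (rule inj_onI)
    fix i j assume ij: "i \<in> {..length xs}" "j \<in> {..length xs}" "?f i = ?f j"
    have "a \<notin> set (take k xs)" "a \<notin> set (drop k xs)" for k
      using assms by (meson in_set_takeD in_set_dropD)+
    \<comment> \<open>Since \<open>a\<close> is absent from \<open>xs\<close>, its only occurrence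
      marks the splitting point, so the two prefixes agree.\<close>
    then have "take i xs = take j xs"
      using ij(3) by (simp add: append_Cons_eq_iff)
    then have "length (take i xs) = length (take j xs)" by simp
    then show "i = j" using ij by simp
  qed
  then show "card (insertions a xs) = Suc (length xs)"
    unfolding eq by (simp add: card_image)
  show "finite (insertions a xs)"
    unfolding eq by simp
qed

section \<open>Structure of the permutations in terms of the first entry\<close>

lemma S2_123_213_iff:
  assumes perm: "x # w \<in> permutations_of_set {1..n}"
  shows "x # w \<in> S2 n [1, 2, 3] [2, 1, 3] \<longleftrightarrow>
    sorted_wrt (>) (filter (\<lambda>b. b \<noteq> 1) w) \<and> x \<le> 3 \<and> (x = 3 \<longrightarrow> \<not> subseq [2, 1] w)"
    (is "_ \<longleftrightarrow> ?desc \<and> _ \<and> _")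
proof -
  have dist: "x \<notin> set w" "distinct w" and set: "insert x (set w) = {1..n}"
    using perm by (auto simp: permutations_of_set_def)
  have w_pos: "b \<ge> 1" if "b \<in> set w" for b
    using set that by auto
  have in_w: "b \<in> set w" if "1 \<le> b" "b < x" for b
  proof -
    have "x \<in> {1..n}" using set by blast
    with that have "b \<in> insert x (set w)" unfolding set by simp
    with that show ?thesis by simp
  qed
  have in_S2: "x # w \<in> S2 n [1, 2, 3] [2, 1, 3] \<longleftrightarrow>
    (\<forall>a b c. subseq [a, b, c] (x # w) \<longrightarrow> \<not> (a < b \<and> b < c)) \<and>
    (\<forall>b a c. subseq [b, a, c] (w @ [x]) \<longrightarrow> \<not> (a < b \<and> b < c))"
  proof -
    have dist_rot: "distinct (w @ [x])" using dist by auto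
    \<comment> \<open>Pattern 213 only gives \<open>\<not> b < a\<close>; distinctness improves this
      to \<open>a < b\<close>, and \<open>a < c\<close> then follows by transitivity.\<close>
    have neq: "b \<noteq> a" if "subseq [b, a, c] (w @ [x])" for a b c
      using subseq_distinct[OF that dist_rot] by simp
    have "contains_pattern (x # w) [1, 2, 3] \<longleftrightarrow>
        (\<exists>a b c. subseq [a, b, c] (x # w) \<and> a < b \<and> b < c)"
      unfolding contains_pattern3 by (intro ex_cong1 conj_cong refl) auto
    moreover have "contains_pattern (w @ [x]) [2, 1, 3] \<longleftrightarrow>
        (\<exists>b a c. subseq [b, a, c] (w @ [x]) \<and> a < b \<and> b < c)"
      unfolding contains_pattern3
      by (intro ex_cong1 conj_cong refl) (auto simp: not_less le_less dest: neq)
    ultimately show ?thesis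
      unfolding S2_def mem_Collect_eq rotate1.simps using perm by blast
  qed
  show ?thesis
  proof
    assume "x # w \<in> S2 n [1, 2, 3] [2, 1, 3]"
    then have no123: "\<And>a b c. subseq [a, b, c] (x # w) \<Longrightarrow> a < b \<Longrightarrow> \<not> b < c"
      and no213: "\<And>a b c. subseq [b, a, c] (w @ [x]) \<Longrightarrow> a < b \<Longrightarrow> \<not> b < c"
      unfolding in_S2 by blast+
    have above: "\<not> b < c" if "subseq [b, c] w" "x < b" for b c
      using no123[of x b c] that by simp
    have below: "\<not> b < x" if "subseq [b, a] w" "a < b" for a b
    proof -
      have "subseq ([b, a] @ [x]) (w @ [x])"
        using that(1) by (rule list_emb_append_mono) auto
      then show ?thesis using no213 that(2) by simp
    qed
    have x: "x \<le> 3"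
    proof (rule ccontr)
      assume "\<not> x \<le> 3"
      then have "x \<ge> 4" by simp
      \<comment> \<open>The bound 4 keeps exactly the values 1, 2, 3, all of them below
        \<open>x\<close> and hence all present in \<open>w\<close>.\<close>
      have "sorted_wrt (<) (filter (\<lambda>b. b < 4) w)"
        unfolding sorted_wrt_iff_subseq
      proof (intro allI impI)
        fix a b assume ab: "subseq [a, b] (filter (\<lambda>b. b < 4) w)"
        then have "a < 4" using list_emb_set[OF ab, of a] by auto
        moreover have "subseq [a, b] w" using ab subseq_filter_left subseq_order.trans by blast
        ultimately show "a < b"
          using below[of a b] subseq_distinct[of "[a, b]", OF _ dist(2)] \<open>x \<ge> 4\<close> by force
      qed
      moreover have "set (filter (\<lambda>b. b < 4) w) = {1..<4}"
        using in_w w_pos \<open>x \<ge> 4\<close> by force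
      ultimately have "filter (\<lambda>b. b < 4) w = [1..<4]"
        by (intro sorted_distinct_set_unique) (auto simp: strict_sorted_iff)
      then have "subseq [1, 2, 3] w"
        using subseq_filter_left[of "\<lambda>b. b < 4" w] by (simp add: upt_rec numeral_eq_Suc)
      then have "subseq [1, 2, 3] (x # w)" by (rule list_emb_Cons)
      then show False using no123 by force
    qed
    have not21: "\<not> subseq [2, 1] w" if "x = 3"
      using below[of 2 1] that by auto
    have ?desc
      unfolding sorted_wrt_iff_subseq
    proof (intro allI impI)
      fix b c assume bc: "subseq [b, c] (filter (\<lambda>b. b \<noteq> 1) w)"
      then have bc_w: "subseq [b, c] w" using subseq_filter_left subseq_order.trans by blast
      have mem: "b \<in> set w" "b \<noteq> 1"
        using list_emb_set[OF bc, of b] by auto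
      then have "b \<ge> 2" "b \<noteq> x" using w_pos[of b] dist by auto
      show "b > c"
      proof (rule ccontr)
        assume "\<not> b > c"
        then have "b < c" using subseq_distinct[OF bc_w dist(2)] by simp
        \<comment> \<open>An ascent starting above \<open>x\<close> is excluded by
          \<open>above\<close>. What remains is 2 \<le> \<open>b\<close> < \<open>x\<close> \<le> 3,
          which fixes both values.\<close>
        then have "b < x" using above[OF bc_w] \<open>b \<noteq> x\<close> by fastforce
        then have "x = 3" "b = 2" using x \<open>b \<ge> 2\<close> by auto
        from split_list[OF mem(1)] obtain u v where w: "w = u @ b # v" by blast
        have "1 \<in> set w" using in_w \<open>x = 3\<close> by simp
        moreover have "1 \<notin> set v"
          using not21 \<open>x = 3\<close> \<open>b = 2\<close> w
          by (auto simp: subseq_singleton_left intro!: list_emb_append2)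
        \<comment> \<open>As 1 stands before \<open>b\<close> while \<open>c\<close> stands after
          it, 1, \<open>b\<close>, \<open>c\<close> form a 123.\<close>
        ultimately have "1 \<in> set u" using w mem by auto
        moreover have "subseq [b, c] (b # v)"
          using subseq_Cons_append_notin[OF bc_w[unfolded w]] dist(2) w by simp
        ultimately have "subseq ([1] @ [b, c]) w"
          unfolding w by (intro list_emb_append_mono) (auto simp: subseq_singleton_left)
        then have "subseq [1, b, c] (x # w)" unfolding append.simps by (rule list_emb_Cons)
        then show False using no123 \<open>b \<ge> 2\<close> \<open>b < c\<close> by force
      qed
    qed
    with x not21 show "?desc \<and> x \<le> 3 \<and> (x = 3 \<longrightarrow> \<not> subseq [2, 1] w)" by blast
  next
    assume A: "?desc \<and> x \<le> 3 \<and> (x = 3 \<longrightarrow> \<not> subseq [2, 1] w)"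
    \<comment> \<open>For the converse, the 2 and 3 of a 123, or of a 213 inside \<open>w\<close>,
      would be an ascent in \<open>w\<close> of entries greater than 1. A 213 that ends at
      \<open>x\<close> \<le> 3 must consist of the values 2, 1, 3 themselves.\<close>
    have desc: "b > c" if "subseq [b, c] w" "b \<noteq> 1" "c \<noteq> 1" for b c
      using A subseq_filter[OF that(1), of "\<lambda>b. b \<noteq> 1"] that(2,3)
      by (auto simp: sorted_wrt_iff_subseq)
    show "x # w \<in> S2 n [1, 2, 3] [2, 1, 3]"
      unfolding in_S2
    proof (intro conjI allI impI notI; elim conjE)
      fix a b c assume abc: "subseq [a, b, c] (x # w)" "a < b" "b < c"
      have "subseq [b, c] w" using abc(1) by (cases "a = x") (auto dest: subseq_Cons')
      moreover have "a \<in> insert x (set w)" using list_emb_set[OF abc(1), of a] by auto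
      then have "a \<ge> 1" using set by auto
      ultimately show False using desc[of b c] abc by simp
    next
      fix a b c assume bac: "subseq [b, a, c] (w @ [x])" "a < b" "b < c"
      have a: "a \<in> set (w @ [x])" using list_emb_set[OF bac(1), of a] by auto
      then have "a \<ge> 1" using set by auto
      \<comment> \<open>The appended \<open>x\<close> can only serve as the last entry of the
        occurrence.\<close>
      have *: "subseq [b, a, c] w \<or> c = x \<and> subseq [b, a] w"
        using bac(1) by (auto simp: subseq_append_iff Cons_eq_append_conv subseq_singleton_left
            split: if_splits)
      then show False
      proof
        assume "subseq [b, a, c] w"
        then have "subseq [b, c] w" by (rule subseq_order.trans[rotated]) simp
        then show False using desc[of b c] bac \<open>a \<ge> 1\<close> by simp
      next
        assume "c = x \<and> subseq [b, a] w"
        moreover from this have "x = 3" "b = 2" "a = 1" using bac A \<open>a \<ge> 1\<close> by auto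
        ultimately show False using A by simp
      qed
    qed
  qed
qed

text \<open>The entries of \<open>w\<close> other than 1 are those of {2..n} without
  \<open>x\<close>, and they have just one decreasing arrangement. As \<open>x\<close> \<ge> 2, the
  value 1 does lie in \<open>w\<close>, and only its place is free.\<close>

lemma Cons_permutation_desc_iff:
  assumes "2 \<le> x" "x \<le> n"
  shows "x # w \<in> permutations_of_set {1..n} \<and> sorted_wrt (>) (filter (\<lambda>b. b \<noteq> 1) w) \<longleftrightarrow>
    w \<in> insertions 1 (filter (\<lambda>b. b \<noteq> x) (rev [2..<Suc n]))"
    (is "?perm \<and> ?desc \<longleftrightarrow> w \<in> insertions 1 ?D")
proof -
  have D: "sorted_wrt (>) ?D" "set ?D = {2..n} - {x}"
    by (auto simp: sorted_wrt_rev intro!: sorted_wrt_filter)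
  have ins: "insertions 1 ?D = {w. filter (\<lambda>b. b \<noteq> 1) w = ?D \<and> count_list w 1 = 1}"
    by (rule insertions_eq) auto
  show ?thesis
  proof
    assume A: "?perm \<and> ?desc"
    then have w: "distinct w" "x \<notin> set w" "insert x (set w) = {1..n}"
      by (auto simp: permutations_of_set_def)
    have set_w: "set w = {1..n} - {x}" using w by blast
    have "filter (\<lambda>b. b \<noteq> 1) w = ?D"
    proof (rule strict_desc_unique[OF _ D(1)])
      show ?desc using A by blast
      show "set (filter (\<lambda>b. b \<noteq> 1) w) = set ?D"
        unfolding D(2) set_filter set_w by force
    qed
    moreover have "1 \<in> set w" using set_w assms by simp
    then obtain u v where "w = u @ 1 # v" by (meson split_list)
    then have "count_list w 1 = 1" using w(1) by (simp add: count_list_0_iff)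
    ultimately show "w \<in> insertions 1 ?D" unfolding ins by simp
  next
    assume "w \<in> insertions 1 ?D"
    then obtain u v where uv: "w = u @ 1 # v" "u @ v = ?D"
      by (auto simp: insertions_def)
    have "distinct ?D" by simp
    then have dist: "distinct (u @ v)" unfolding uv(2) .
    have set_uv: "set u \<union> set v = {2..n} - {x}" using D(2) unfolding uv(2)[symmetric] by simp
    then have "1 \<notin> set u \<union> set v" "x \<notin> set u \<union> set v" by simp_all
    moreover have "insert x (insert 1 (set u \<union> set v)) = {1..n}"
      unfolding set_uv using assms by auto
    ultimately have ?perm
      using assms dist by (auto simp: uv(1) permutations_of_set_def)
    moreover have ?desc
      using \<open>w \<in> insertions 1 ?D\<close> D(1) unfolding ins by simp
    ultimately show "?perm \<and> ?desc" ..
  qed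
qed

text \<open>Keeping \<open>a\<close> in front of the final \<open>y\<close> means that
  \<open>y\<close> stays last, so \<open>a\<close> is inserted into \<open>xs\<close>. For first
  entry 3 this is applied with \<open>y\<close> = 2 and \<open>a\<close> = 1, where 2 ends the
  decreasing list.\<close>

lemma insertions_snoc_before:
  assumes "distinct (xs @ [y])" "a \<notin> set (xs @ [y])"
  shows "{w \<in> insertions a (xs @ [y]). \<not> subseq [y, a] w} = (\<lambda>w. w @ [y]) ` insertions a xs"
proof (intro equalityI subsetI)
  fix w assume "w \<in> {w \<in> insertions a (xs @ [y]). \<not> subseq [y, a] w}"
  then obtain u v where uv: "w = u @ a # v" "u @ v = xs @ [y]" and *: "\<not> subseq [y, a] w"
    by (auto simp: insertions_def)
  show "w \<in> (\<lambda>w. w @ [y]) ` insertions a xs"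
  proof (cases v rule: rev_cases)
    case Nil
    then have "w = xs @ [y, a]" using uv by simp
    then have "subseq [y, a] w" by (simp add: list_emb_append2)
    with * show ?thesis by simp
  next
    case (snoc v' y')
    then have "w = (u @ a # v') @ [y]" "u @ v' = xs" using uv by auto
    then show ?thesis unfolding insertions_def by blast
  qed
next
  fix w assume "w \<in> (\<lambda>w. w @ [y]) ` insertions a xs"
  then obtain u v where uv: "w = u @ a # v @ [y]" "u @ v = xs"
    by (auto simp: insertions_def)
  have "\<not> subseq [y, a] w"
  proof
    assume "subseq [y, a] w"
    then have "subseq [y, a] ((u @ a # v) @ [y])" by (simp add: uv(1))
    \<comment> \<open>By distinctness \<open>y\<close> occurs only at the very end, leaving no room
      for \<open>a\<close> after it.\<close>
    then have "subseq [y, a] [y]"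
      by (rule subseq_Cons_append_notin) (use assms uv(2) in auto)
    then show False by simp
  qed
  moreover have "w \<in> insertions a (xs @ [y])"
    unfolding insertions_def mem_Collect_eq using uv
    by (intro exI[of _ u] exI[of _ "v @ [y]"]) simp
  ultimately show "w \<in> {w \<in> insertions a (xs @ [y]). \<not> subseq [y, a] w}" by simp
qed

section \<open>Counting by first entry\<close>

theorem proposition5p6:
  fixes n :: nat
  assumes "n \<ge> 2"
  shows "card (S2 n [1, 2, 3] [2, 1, 3]) = 2 * n - 2"
proof -
  let ?S = "S2 n [1, 2, 3] [2, 1, 3]"
  \<comment> \<open>\<open>F x\<close> collects the tails of the permutations with first entry
    \<open>x\<close>; prepending \<open>x\<close> is injective, so tails may be counted
    instead.\<close>
  define F where "F x = {w. x # w \<in> ?S}" for x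
  have F_iff: "w \<in> F x \<longleftrightarrow> x # w \<in> permutations_of_set {1..n} \<and>
      sorted_wrt (>) (filter (\<lambda>b. b \<noteq> 1) w) \<and> x \<le> 3 \<and> (x = 3 \<longrightarrow> \<not> subseq [2, 1] w)" for x w
    using S2_123_213_iff[of x w n] by (auto simp: F_def S2_def)
  have S_eq: "?S = (\<Union>x\<in>{1, 2, 3}. (#) x ` F x)"
  proof (intro equalityI subsetI)
    fix p assume p: "p \<in> ?S"
    then have perm: "p \<in> permutations_of_set {1..n}" by (simp add: S2_def)
    then obtain x w where xw: "p = x # w"
      using assms by (cases p) (auto simp: permutations_of_set_def)
    then have "w \<in> F x" "x \<in> {1..n}" using p perm by (auto simp: F_def permutations_of_set_def)
    then have "x \<in> {1, 2, 3}" by (auto simp: F_iff)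
    with \<open>w \<in> F x\<close> xw show "p \<in> (\<Union>x\<in>{1, 2, 3}. (#) x ` F x)" by blast
  qed (auto simp: F_def)
  have F1: "F 1 = {rev [2..<Suc n]}"
  proof (intro equalityI subsetI)
    fix w assume "w \<in> F 1"
    then have w: "1 \<notin> set w" "insert 1 (set w) = {1..n}" "sorted_wrt (>) (filter (\<lambda>b. b \<noteq> 1) w)"
      unfolding F_iff permutations_of_set_def by simp_all
    \<comment> \<open>With 1 as first entry the filter removes nothing, so all of \<open>w\<close>
      is decreasing and therefore unique.\<close>
    have "filter (\<lambda>b. b \<noteq> 1) w = w"
      unfolding filter_id_conv using w(1) by metis
    then have desc: "sorted_wrt (>) w" using w(3) by simp
    have "set w = {1..n} - {1}" using w(1,2) by blast
    then have "set w = set (rev [2..<Suc n])" by (simp only: set_rev set_upt) force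
    moreover have "sorted_wrt (>) (rev [2..<Suc n])" by (simp add: sorted_wrt_rev del: upt_Suc)
    ultimately have "w = rev [2..<Suc n]" using strict_desc_unique[OF desc] by blast
    then show "w \<in> {rev [2..<Suc n]}" by simp
  next
    fix w assume "w \<in> {rev [2..<Suc n]}"
    then have w: "w = rev [2..<Suc n]" by simp
    have "filter (\<lambda>b. b \<noteq> 1) w = w" unfolding w by (simp add: filter_id_conv del: upt_Suc)
    then show "w \<in> F 1"
      using assms by (auto simp: F_iff permutations_of_set_def w sorted_wrt_rev)
  qed
  have F2: "F 2 = insertions 1 (rev [3..<Suc n])"
  proof -
    have "[2..<Suc n] = 2 # [3..<Suc n]"
      using assms by (subst upt_rec) (simp add: numeral_eq_Suc)
    then have "filter (\<lambda>b. b \<noteq> 2) (rev [2..<Suc n]) = rev [3..<Suc n]"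
      by (simp add: filter_id_conv del: upt_Suc)
    then show ?thesis
      using Cons_permutation_desc_iff[of 2 n] assms by (auto simp: F_iff)
  qed
  have F3: "F 3 = (\<lambda>w. w @ [2]) ` insertions 1 (rev [4..<Suc n])" if "n \<ge> 3"
  proof -
    \<comment> \<open>Splitting off 2 and 3 shows that, after reversal and removal of 3, the
      decreasing list ends in 2.\<close>
    have "[2..<Suc n] = 2 # 3 # [4..<Suc n]"
      using that by (subst upt_rec, subst upt_rec) (simp add: numeral_eq_Suc)
    then have "filter (\<lambda>b. b \<noteq> 3) (rev [2..<Suc n]) = rev [4..<Suc n] @ [2]"
      by (simp add: filter_id_conv del: upt_Suc)
    then have "3 # w \<in> permutations_of_set {1..n} \<and> sorted_wrt (>) (filter (\<lambda>b. b \<noteq> 1) w) \<longleftrightarrow>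
        w \<in> insertions 1 (rev [4..<Suc n] @ [2])" for w
      using Cons_permutation_desc_iff[of 3 n w] that by (simp del: upt_Suc)
    then have "w \<in> F 3 \<longleftrightarrow> w \<in> insertions 1 (rev [4..<Suc n] @ [2]) \<and> \<not> subseq [2, 1] w" for w
      unfolding F_iff by (metis order_refl)
    then have "F 3 = {w \<in> insertions 1 (rev [4..<Suc n] @ [2]). \<not> subseq [2, 1] w}"
      by blast
    also have "\<dots> = (\<lambda>w. w @ [2]) ` insertions 1 (rev [4..<Suc n])"
      by (rule insertions_snoc_before) auto
    finally show ?thesis .
  qed
  \<comment> \<open>This is the case \<open>n\<close> = 2, where 3 is not a value; it agrees with
    the count \<open>n - 2\<close>.\<close>
  have F3_empty: "F 3 = {}" if "n < 3"
  proof -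
    have "3 \<notin> {1..n}" using that by simp
    then have "3 # w \<notin> permutations_of_set {1..n}" for w
      by (metis insertI1 list.simps(15) permutations_of_setD(1))
    then show ?thesis by (auto simp: F_iff)
  qed
  \<comment> \<open>The list \<open>[3..<Suc n]\<close> has \<open>n - 2\<close> entries, hence
    \<open>n - 1\<close> places for 1.\<close>
  have card_F2: "card (F 2) = n - 1"
    unfolding F2 using assms by (subst card_insertions) auto
  have card_F3: "card (F 3) = n - 2"
  proof (cases "n \<ge> 3")
    case True
    then show ?thesis
      \<comment> \<open>Here \<open>[4..<Suc n]\<close> has \<open>n - 3\<close> entries, and
        appending 2 is injective.\<close>
      unfolding F3[OF True] by (subst card_image) (auto simp: card_insertions inj_on_def)
  qed (use F3_empty in simp)
  have fin: "finite (F x)" for x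
  proof (rule finite_imageD)
    have "finite ?S"
      by (rule finite_subset[of _ "permutations_of_set {1..n}"]) (auto simp: S2_def)
    then show "finite ((#) x ` F x)"
      by (rule finite_subset[rotated]) (auto simp: F_def)
  qed simp
  \<comment> \<open>The three images are disjoint because their lists start with different
    values.\<close>
  have "card ?S = (\<Sum>x\<in>{1, 2, 3}. card ((#) x ` F x))"
    unfolding S_eq using fin by (intro card_UN_disjoint) auto
  also have "\<dots> = card (F 1) + card (F 2) + card (F 3)"
    by (simp add: card_image)
  \<comment> \<open>The total is 1 + (\<open>n\<close> - 1) + (\<open>n\<close> - 2).\<close>
  also have "\<dots> = 2 * n - 2"
    unfolding card_F2 card_F3 F1 using assms by simp
  finally show ?thesis .
qed

end
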